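(* Let $L_0$ be a finite co-Brouwerian semilattice and $L$ an extension of $L_0$ (not necessarily finite). Let $(x_1,x_2)\in L^2$ be a primitive couple of the second kind over $L_0$, i.e. $x_1,x_2\notin L_0$, $x_1\neq x_2$, and there exists a join-irreducible element $g$ of $L_0$ such that $g-x_1=x_2$, $g-x_2=x_1$, and for every join-irreducible element $a$ of $L_0$ with $a<g$ one has $a-x_i\in L_0$ for $i=1,2$. Then the sub-CBS $L_0\langle x_1,x_2\rangle$ of $L$ generated by $L_0\cup\{x_1,x_2\}$ is a finite minimal extension of $L_0$ of the second kind.
   Context: A co-Brouwerian semilattice (CBS) is a poset with least element $0$, binary joins $\vee$ and a difference $-$ characterized by $a-b\le c$ iff $a\le b\vee c$; sub-CBSes and extensions are in the signature $(0,\vee,-)$. An element $g$ of a CBS $K$ is join-irreducible if for all $n\ge0$ and $b_1,\dots,b_n\in K$, $g\le b_1\vee\dots\vee b_n$ implies $g\le b_i$ for some $i$; a join-irreducible component of $a$ is a maximal element among the join-irreducibles below $a$. An extension $L_0\subseteq L_1$ of finite CBSes is minimal if $L_0\ne L_1$ and no sub-CBS lies strictly between them. A minimal extension $L_0\subseteq L_1$ of finite CBSes is of the first kind if some join-irreducible element of $L_1$ is not a join-irreducible component (in $L_1$) of any join-irreducible element of $L_0$, and of the second kind otherwise. *)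

theory Defs
  imports Main HOL.Hull
begin

text \<open>
  Sub-CBSes of an ambient CBS are represented as subsets of its type that are closed under the
  signature \<open>(bot, sup, -)\<close>. Order-theoretic notions that depend on the CBS in which they are
  taken (such as join-irreducibility) carry that subset \<open>K\<close> as a parameter.
\<close>

class cbs = bounded_semilattice_sup_bot + minus +
  assumes diff_le_iff: "a - b \<le> c \<longleftrightarrow> a \<le> sup b c"

definition sub_cbs :: "'a::cbs set \<Rightarrow> bool" where
  "sub_cbs K \<longleftrightarrow> bot \<in> K \<and> (\<forall>a\<in>K. \<forall>b\<in>K. sup a b \<in> K \<and> a - b \<in> K)"

text \<open>The empty list is allowed (\<open>n = 0\<close>), so \<open>bot\<close> is not join-irreducible.\<close>

definition join_irreducible :: "'a::cbs set \<Rightarrow> 'a \<Rightarrow> bool" where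
  "join_irreducible K g \<longleftrightarrow>
     g \<in> K \<and> (\<forall>bs. set bs \<subseteq> K \<longrightarrow> g \<le> foldr sup bs bot \<longrightarrow> (\<exists>b\<in>set bs. g \<le> b))"

definition ji_component :: "'a::cbs set \<Rightarrow> 'a \<Rightarrow> 'a \<Rightarrow> bool" where
  "ji_component K h a \<longleftrightarrow>
     join_irreducible K h \<and> h \<le> a \<and>
     (\<forall>k. join_irreducible K k \<longrightarrow> k \<le> a \<longrightarrow> h \<le> k \<longrightarrow> k = h)"

definition minimal_extension :: "'a::cbs set \<Rightarrow> 'a set \<Rightarrow> bool" where
  "minimal_extension L0 L1 \<longleftrightarrow>
     sub_cbs L0 \<and> finite L0 \<and> sub_cbs L1 \<and> finite L1 \<and> L0 \<subset> L1 \<and>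
     \<not> (\<exists>M. sub_cbs M \<and> L0 \<subset> M \<and> M \<subset> L1)"

definition minimal_extension_first_kind :: "'a::cbs set \<Rightarrow> 'a set \<Rightarrow> bool" where
  "minimal_extension_first_kind L0 L1 \<longleftrightarrow>
     minimal_extension L0 L1 \<and>
     (\<exists>h. join_irreducible L1 h \<and>
        \<not> (\<exists>a. join_irreducible L0 a \<and> ji_component L1 h a))"

definition minimal_extension_second_kind :: "'a::cbs set \<Rightarrow> 'a set \<Rightarrow> bool" where
  "minimal_extension_second_kind L0 L1 \<longleftrightarrow>
     minimal_extension L0 L1 \<and> \<not> minimal_extension_first_kind L0 L1"

definition primitive_couple_second_kind :: "'a::cbs set \<Rightarrow> 'a \<Rightarrow> 'a \<Rightarrow> bool" where
  "primitive_couple_second_kind L0 x1 x2 \<longleftrightarrow>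
     x1 \<notin> L0 \<and> x2 \<notin> L0 \<and> x1 \<noteq> x2 \<and>
     (\<exists>g. join_irreducible L0 g \<and> g - x1 = x2 \<and> g - x2 = x1 \<and>
        (\<forall>a. join_irreducible L0 a \<longrightarrow> a < g \<longrightarrow> a - x1 \<in> L0 \<and> a - x2 \<in> L0))"

end

theory Submission imports Defs begin

text \<open>
  If \<open>g\<close> is join-irreducible in \<open>L0\<close> and \<open>a \<in> L0\<close> is not above \<open>g\<close>, then
  \<open>g - a = g\<close>, and hence \<open>x1 - a = (g - a) - x2 = x1\<close>. Together with \<open>x1 \<squnion> x2 = g\<close> this shows that
  \<open>L0\<close> and the joins \<open>a \<squnion> x1\<close>, \<open>a \<squnion> x2\<close> with \<open>a \<in> L0\<close> already form a sub-CBS. It is minimal,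
  because \<open>a \<squnion> x1 \<notin> L0\<close> forces \<open>g - (a \<squnion> x1) = g - x1 = x2\<close>, and \<open>x1 = g - x2\<close>. Its
  join-irreducibles other than \<open>x1\<close> and \<open>x2\<close> lie in \<open>L0\<close>, and \<open>x1\<close>, \<open>x2\<close> can only be components
  of \<open>g\<close>, since every element of \<open>L0\<close> above one of them is above \<open>g\<close>.
\<close>

section \<open>Arithmetic of joins and differences\<close>

lemma le_sup_diff: "a \<le> sup b (a - b)" for a :: "'a::cbs"
  using diff_le_iff by blast

lemma diff_le: "a - b \<le> a" for a :: "'a::cbs"
  by (simp add: diff_le_iff)

lemma diff_eq_bot: "a \<le> b \<Longrightarrow> a - b = bot" for a :: "'a::cbs"
  by (metis bot.extremum_uniqueI diff_le_iff sup.coboundedI1)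

lemma diff_mono_left: "a \<le> b \<Longrightarrow> a - c \<le> b - c" for a :: "'a::cbs"
  by (meson diff_le_iff le_sup_diff order_trans)

lemma sup_right_commute: "sup (sup a b) c = sup (sup a c) b" for a :: "'a::semilattice_sup"
  by (simp add: ac_simps)

lemma sup_diff_distrib: "sup a b - c = sup (a - c) (b - c)" for a :: "'a::cbs"
proof (rule order.antisym)
  have "sup a b \<le> sup (sup c (a - c)) (sup c (b - c))"
    by (rule sup.mono[OF le_sup_diff le_sup_diff])
  also have "\<dots> = sup c (sup (a - c) (b - c))" by (simp add: ac_simps)
  finally show "sup a b - c \<le> sup (a - c) (b - c)" by (simp only: diff_le_iff)
  show "sup (a - c) (b - c) \<le> sup a b - c"
    by (simp add: diff_mono_left)
qed

lemma diff_sup: "a - sup b c = (a - b) - c" for a :: "'a::cbs"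
  by (rule order.antisym) (metis diff_le_iff order_refl sup_assoc)+

lemma diff_antimono: "b \<le> c \<Longrightarrow> a - c \<le> a - b" for a :: "'a::cbs"
  by (metis diff_le diff_sup sup.absorb2)

lemma diff_diff_commute: "(a - b) - c = (a - c) - b" for a :: "'a::cbs"
  by (metis diff_sup sup_commute)

section \<open>Join-irreducible elements\<close>

lemma foldr_sup_in_sub_cbs: "sub_cbs K \<Longrightarrow> set bs \<subseteq> K \<Longrightarrow> foldr sup bs bot \<in> K"
  by (induction bs) (auto simp: sub_cbs_def)

text \<open>The empty list yields \<open>g \<noteq> bot\<close> and two-element lists the binary
  condition; conversely, partial joins stay in \<open>K\<close>, so induction on the list
  applies.\<close>

lemma join_irreducible_iff:
  assumes "sub_cbs K"
  shows "join_irreducible K g \<longleftrightarrow>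
    g \<in> K \<and> g \<noteq> bot \<and> (\<forall>a\<in>K. \<forall>b\<in>K. g \<le> sup a b \<longrightarrow> g \<le> a \<or> g \<le> b)"
proof
  assume ji: "join_irreducible K g"
  have "g \<noteq> bot"
    using ji unfolding join_irreducible_def by (metis all_not_in_conv empty_subsetI foldr.simps(1) id_apply list.set(1) order_refl)
  moreover have "g \<le> a \<or> g \<le> b" if "a \<in> K" "b \<in> K" "g \<le> sup a b" for a b
    using ji[unfolded join_irreducible_def, THEN conjunct2, rule_format, of "[a, b]"] that by auto
  ultimately show "g \<in> K \<and> g \<noteq> bot \<and> (\<forall>a\<in>K. \<forall>b\<in>K. g \<le> sup a b \<longrightarrow> g \<le> a \<or> g \<le> b)"
    using ji by (auto simp: join_irreducible_def)
next
  assume R: "g \<in> K \<and> g \<noteq> bot \<and> (\<forall>a\<in>K. \<forall>b\<in>K. g \<le> sup a b \<longrightarrow> g \<le> a \<or> g \<le> b)"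
  have "\<exists>b\<in>set bs. g \<le> b" if "set bs \<subseteq> K" "g \<le> foldr sup bs bot" for bs
    using that
  proof (induction bs)
    case Nil
    then show ?case using R by (simp add: bot.extremum_unique)
  next
    case (Cons b bs)
    then have "g \<le> b \<or> g \<le> foldr sup bs bot"
      using R foldr_sup_in_sub_cbs[OF assms, of bs] by auto
    with Cons show ?case by auto
  qed
  with R show "join_irreducible K g" by (auto simp: join_irreducible_def)
qed

lemma join_irreducible_diff:
  assumes "sub_cbs K" "join_irreducible K g" "a \<in> K" "\<not> g \<le> a"
  shows "g - a = g"
proof (rule order.antisym[OF diff_le])
  have "g - a \<in> K" using assms by (auto simp: sub_cbs_def join_irreducible_def)
  then show "g \<le> g - a"
    using assms le_sup_diff[of g a] by (auto simp: join_irreducible_iff)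
qed

lemma join_irreducible_subset:
  "join_irreducible K g \<Longrightarrow> K' \<subseteq> K \<Longrightarrow> g \<in> K' \<Longrightarrow> join_irreducible K' g"
  unfolding join_irreducible_def by blast

lemma join_irreducible_component_self: "join_irreducible K h \<Longrightarrow> ji_component K h h"
  by (auto simp: ji_component_def)

text \<open>In a finite CBS every element is a join of join-irreducibles.\<close>

lemma finite_sub_cbs_induct [consumes 3, case_names bot ji sup]:
  assumes "sub_cbs K" "finite K" "a \<in> K"
    and bot: "P bot"
    and ji: "\<And>a. join_irreducible K a \<Longrightarrow> P a"
    and sup: "\<And>a b. a \<in> K \<Longrightarrow> b \<in> K \<Longrightarrow> P a \<Longrightarrow> P b \<Longrightarrow> P (sup a b)"
  shows "P a"
  using assms(3)
proof (induction "card {b \<in> K. b < a}" arbitrary: a rule: less_induct)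
  case less
  have IH: "P b" if "b \<in> K" "b < a" for b
  proof (rule less.hyps)
    show "card {c \<in> K. c < b} < card {c \<in> K. c < a}"
      using that \<open>finite K\<close> by (intro psubset_card_mono) auto
  qed fact
  consider "a = bot" | "join_irreducible K a"
    | b c where "b \<in> K" "c \<in> K" "a \<le> sup b c" "\<not> a \<le> b" "\<not> a \<le> c"
    using \<open>a \<in> K\<close> \<open>sub_cbs K\<close> by (auto simp: join_irreducible_iff)
  then show ?case
  proof cases
    case 3
    \<comment> \<open>These split \<open>a\<close> into two strictly smaller elements:
      \<open>?u\<close> lies below \<open>c\<close> and \<open>?v\<close> below \<open>b\<close>,
      neither of which is above \<open>a\<close>.\<close>
    let ?u = "a - b" and ?v = "a - (a - b)"
    have "?u \<in> K" "?v \<in> K"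
      using \<open>sub_cbs K\<close> \<open>a \<in> K\<close> 3 by (auto simp: sub_cbs_def)
    moreover have "?u < a"
      using 3 diff_le[of a b] diff_le_iff[of a b c] by (auto simp: less_le)
    moreover have "?v \<le> b"
      by (metis diff_le_iff le_sup_diff sup_commute)
    then have "?v < a"
      using 3 diff_le[of a "?u"] by (auto simp: less_le)
    moreover have "a = sup ?u ?v"
      by (intro order.antisym le_sup_diff sup_least diff_le)
    ultimately show ?thesis by (metis IH sup)
  qed (use bot ji in auto)
qed

section \<open>Primitive couples with a fixed \<open>g\<close>\<close>

locale primitive_pair =
  fixes L0 :: "'a::cbs set" and x1 x2 g :: 'a
  assumes sub: "sub_cbs L0" and fin: "finite L0"
    and notin: "x1 \<notin> L0" "x2 \<notin> L0"
    and ji: "join_irreducible L0 g"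
    and diff: "g - x1 = x2" "g - x2 = x1"
    and below: "\<And>a. join_irreducible L0 a \<Longrightarrow> a < g \<Longrightarrow> a - x1 \<in> L0"
      "\<And>a. join_irreducible L0 a \<Longrightarrow> a < g \<Longrightarrow> a - x2 \<in> L0"
begin

text \<open>By this symmetry, facts are proved for \<open>x1\<close> and transferred to
  \<open>x2\<close>.\<close>

lemma swap: "primitive_pair L0 x2 x1 g"
  using primitive_pair_axioms by (simp add: primitive_pair_def)

lemma L0_closed: "a \<in> L0 \<Longrightarrow> b \<in> L0 \<Longrightarrow> sup a b \<in> L0" "a \<in> L0 \<Longrightarrow> b \<in> L0 \<Longrightarrow> a - b \<in> L0"
  "bot \<in> L0"
  using sub by (auto simp: sub_cbs_def)

lemma g_in: "g \<in> L0"
  using ji by (simp add: join_irreducible_def)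

lemma le_g: "x1 \<le> g"
  using diff(2) diff_le by metis

lemma sup_eq_g: "sup x1 x2 = g"
  by (metis diff diff_le le_sup_diff order.antisym sup_least)

lemma diff_L0: "a \<in> L0 \<Longrightarrow> \<not> g \<le> a \<Longrightarrow> x1 - a = x1"
  by (metis diff(2) diff_diff_commute join_irreducible_diff[OF sub ji])

text \<open>Otherwise \<open>x1 = x1 - a = bot\<close>, which lies in \<open>L0\<close>.\<close>

lemma le_L0: "a \<in> L0 \<Longrightarrow> x1 \<le> a \<Longrightarrow> g \<le> a"
  using diff_L0 diff_eq_bot L0_closed(3) notin(1) by metis

lemma diff_other: "x1 - x2 = x1"
  by (metis diff(2) diff_sup sup.idem)

lemma not_le_other: "\<not> x1 \<le> x2"
  using diff_other diff_eq_bot L0_closed(3) notin(1) by metis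

text \<open>Joins with both \<open>x1\<close> and \<open>x2\<close> are joins with \<open>g\<close>
  and hence already in \<open>L0\<close>; \<open>x1\<close> and \<open>x2\<close> themselves arise
  from joining with \<open>bot\<close>.\<close>

definition ext :: "'a set" where
  "ext = L0 \<union> sup x1 ` L0 \<union> sup x2 ` L0"

lemma ext_swap: "primitive_pair.ext L0 x2 x1 = ext"
  using primitive_pair.ext_def[OF swap] by (auto simp: ext_def)

lemma ext_cases [consumes 1, case_names L0 x1 x2]:
  assumes "u \<in> ext"
  obtains "u \<in> L0" | a where "a \<in> L0" "u = sup a x1" | a where "a \<in> L0" "u = sup a x2"
  using assms by (auto simp: ext_def sup_commute)

lemma ext_intros: "a \<in> L0 \<Longrightarrow> a \<in> ext" "a \<in> L0 \<Longrightarrow> sup a x1 \<in> ext" "a \<in> L0 \<Longrightarrow> sup a x2 \<in> ext"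
  "x1 \<in> ext" "x2 \<in> ext"
proof -
  show "a \<in> L0 \<Longrightarrow> a \<in> ext" "a \<in> L0 \<Longrightarrow> sup a x1 \<in> ext" "a \<in> L0 \<Longrightarrow> sup a x2 \<in> ext"
    by (auto simp: ext_def sup_commute)
  have "sup x1 bot \<in> ext" "sup x2 bot \<in> ext"
    unfolding ext_def using L0_closed(3) by blast+
  then show "x1 \<in> ext" "x2 \<in> ext" by simp_all
qed

lemma finite_ext: "finite ext"
  using fin by (simp add: ext_def)

section \<open>Closure of \<open>ext\<close> under joins and differences\<close>

lemma sup_x1_in_ext:
  assumes "u \<in> ext"
  shows "sup u x1 \<in> ext"
  using assms
proof (cases rule: ext_cases)
  case (x2 a)
  then have "sup u x1 = sup a g" by (simp add: sup_eq_g[symmetric] ac_simps)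
  then show ?thesis using x2 L0_closed g_in by (simp add: ext_intros)
qed (auto simp: ext_intros sup_assoc)

lemma sup_x2_in_ext: "u \<in> ext \<Longrightarrow> sup u x2 \<in> ext"
  using primitive_pair.sup_x1_in_ext[OF swap] by (simp add: ext_swap)

lemma sup_L0_in_ext: "u \<in> ext \<Longrightarrow> a \<in> L0 \<Longrightarrow> sup u a \<in> ext"
  by (erule ext_cases) (auto simp: ext_intros L0_closed sup_right_commute)

lemma sup_in_ext: "u \<in> ext \<Longrightarrow> v \<in> ext \<Longrightarrow> sup u v \<in> ext"
  by (erule ext_cases[of v])
    (auto simp: sup_L0_in_ext sup_x1_in_ext sup_x2_in_ext sup_assoc[symmetric])

lemma L0_diff_x1_in_ext:
  assumes "a \<in> L0"
  shows "a - x1 \<in> ext"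
  using sub fin assms
proof (induction a rule: finite_sub_cbs_induct)
  case bot
  then show ?case using L0_closed(3) diff_eq_bot[of bot x1] by (simp add: ext_intros)
next
  case (ji a)
  \<comment> \<open>These give, in turn, \<open>x2\<close>, an element of \<open>L0\<close> by
    \<open>below\<close>, and \<open>a\<close> itself, since
    \<open>a = a - g \<le> a - x1 \<le> a\<close>.\<close>
  consider "a = g" | "a < g" | "\<not> a \<le> g" by (auto simp: less_le)
  then show ?case
  proof cases
    case 3
    have "a = a - g" using join_irreducible_diff[OF sub ji g_in] 3 by simp
    then have "a - x1 = a" by (metis diff_antimono diff_le le_g order.antisym)
    then show ?thesis using ji by (simp add: ext_intros join_irreducible_def)
  qed (use diff below ji in \<open>auto simp: ext_intros\<close>)
next
  case (sup a b)
  then show ?case by (simp add: sup_diff_distrib sup_in_ext)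
qed

text \<open>The difference is \<open>bot\<close> if \<open>g \<le> a\<close>, and \<open>x1\<close>
  otherwise.\<close>

lemma x1_diff_L0_in_ext: "a \<in> L0 \<Longrightarrow> x1 - a \<in> ext"
  by (metis diff_L0 diff_eq_bot ext_intros(1,4) L0_closed(3) le_g order_trans)

lemma ext_diff_L0_in_ext: "u \<in> ext \<Longrightarrow> a \<in> L0 \<Longrightarrow> u - a \<in> ext"
  using primitive_pair.x1_diff_L0_in_ext[OF swap]
  by (erule_tac ext_cases)
    (auto simp: ext_swap ext_intros L0_closed sup_diff_distrib sup_in_ext x1_diff_L0_in_ext)

lemma ext_diff_x1_in_ext: "u \<in> ext \<Longrightarrow> u - x1 \<in> ext"
  using primitive_pair.diff_other[OF swap]
  by (erule_tac ext_cases)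
    (auto simp: ext_intros L0_closed sup_diff_distrib sup_in_ext L0_diff_x1_in_ext diff_eq_bot)

lemma ext_diff_x2_in_ext: "u \<in> ext \<Longrightarrow> u - x2 \<in> ext"
  using primitive_pair.ext_diff_x1_in_ext[OF swap] by (simp add: ext_swap)

lemma sub_cbs_ext: "sub_cbs ext"
proof -
  \<comment> \<open>By \<open>diff_sup\<close>, subtracting \<open>sup a x1\<close> amounts to
    subtracting \<open>a\<close> and then \<open>x1\<close>, and similarly for
    \<open>x2\<close>.\<close>
  have "u - v \<in> ext" if "u \<in> ext" "v \<in> ext" for u v
    using that(2)
    by (cases rule: ext_cases)
      (auto simp: diff_sup that ext_diff_L0_in_ext ext_diff_x1_in_ext ext_diff_x2_in_ext)
  then show ?thesis
    by (simp add: sub_cbs_def sup_in_ext ext_intros L0_closed)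
qed

section \<open>Generation and minimality\<close>

lemma ext_least: "sub_cbs M \<Longrightarrow> L0 \<subseteq> M \<Longrightarrow> x1 \<in> M \<Longrightarrow> x2 \<in> M \<Longrightarrow> ext \<subseteq> M"
  by (auto simp: ext_def sub_cbs_def)

lemma hull_eq_ext: "sub_cbs hull (L0 \<union> {x1, x2}) = ext"
  by (rule hull_unique) (auto simp: sub_cbs_ext ext_intros intro: ext_least[THEN subsetD])

lemma x2_in_if_sup_x1_in:
  assumes "sub_cbs M" "L0 \<subseteq> M" "a \<in> L0" "sup a x1 \<in> M" "sup a x1 \<notin> L0"
  shows "x2 \<in> M"
proof -
  \<comment> \<open>If \<open>g \<le> a\<close>, then \<open>x1 \<le> a\<close> and
    \<open>sup a x1\<close> would be \<open>a\<close>, an element of \<open>L0\<close>.\<close>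
  have "\<not> g \<le> a" using assms le_g by (metis order_trans sup.absorb1)
  then have "x2 = g - sup a x1"
    using join_irreducible_diff[OF sub ji] assms by (simp add: diff_sup diff)
  then show ?thesis using assms g_in by (auto simp: sub_cbs_def)
qed

lemma ext_minimal:
  assumes M: "sub_cbs M" "L0 \<subset> M" "M \<subseteq> ext"
  shows "M = ext"
proof -
  obtain u where u: "u \<in> M" "u \<notin> L0" using M by blast
  have gd: "g - x \<in> M" if "x \<in> M" for x
    using that M g_in by (auto simp: sub_cbs_def)
  from u M have "u \<in> ext" by blast
  then have "x1 \<in> M \<or> x2 \<in> M"
    using u M x2_in_if_sup_x1_in[of M] primitive_pair.x2_in_if_sup_x1_in[OF swap, of M]
    by (cases rule: ext_cases) auto
  then have "x1 \<in> M" "x2 \<in> M" using gd diff by metis+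
  with M ext_least show ?thesis by blast
qed

lemma minimal_extension_ext: "minimal_extension L0 ext"
  unfolding minimal_extension_def
  using sub fin sub_cbs_ext finite_ext notin ext_intros ext_minimal by blast

section \<open>Join-irreducibles of \<open>ext\<close> and their components\<close>

lemma join_irreducible_ext_cases:
  assumes "join_irreducible ext h"
  shows "h \<in> L0 \<or> h = x1 \<or> h = x2"
proof -
  have h: "h \<in> ext" "\<And>a b. a \<in> ext \<Longrightarrow> b \<in> ext \<Longrightarrow> h \<le> sup a b \<Longrightarrow> h \<le> a \<or> h \<le> b"
    using assms join_irreducible_iff[OF sub_cbs_ext] by auto
  show ?thesis
    using h(1)
  proof (cases rule: ext_cases)
    case (x1 a)
    \<comment> \<open>As \<open>a\<close> and \<open>x1\<close> both lie below \<open>h\<close>,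
      this forces \<open>h\<close> to equal one of them.\<close>
    then have "h \<le> a \<or> h \<le> x1" using h(2)[of a x1] by (simp add: ext_intros)
    then show ?thesis using x1 by (metis order.antisym sup_ge1 sup_ge2)
  next
    case (x2 a)
    then have "h \<le> a \<or> h \<le> x2" using h(2)[of a x2] by (simp add: ext_intros)
    then show ?thesis using x2 by (metis order.antisym sup_ge1 sup_ge2)
  qed simp
qed

lemma x1_component_g:
  assumes "join_irreducible ext x1"
  shows "ji_component ext x1 g"
  unfolding ji_component_def
proof (intro conjI allI impI)
  fix k assume k: "join_irreducible ext k" "k \<le> g" "x1 \<le> k"
  \<comment> \<open>An element of \<open>L0\<close> between \<open>x1\<close> and \<open>g\<close>
    is \<open>g\<close>, but \<open>g = sup x1 x2\<close> is strictly above both parts and so not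
    join-irreducible in \<open>ext\<close>. What remains is \<open>k = x1\<close> or
    \<open>k = x2\<close>, and \<open>x1 \<le> x2\<close> is impossible.\<close>
  have "k \<notin> L0"
  proof
    assume "k \<in> L0"
    then have "k = g" using k le_L0 by (auto intro: order.antisym)
    then have "\<forall>a\<in>ext. \<forall>b\<in>ext. g \<le> sup a b \<longrightarrow> g \<le> a \<or> g \<le> b"
      using k by (simp add: join_irreducible_iff[OF sub_cbs_ext])
    then have "g \<le> x1 \<or> g \<le> x2"
      using ext_intros(4,5) by (simp add: sup_eq_g)
    then show False
      using le_g primitive_pair.le_g[OF swap] notin g_in by (metis order.antisym)
  qed
  then show "k = x1"
    using k join_irreducible_ext_cases not_le_other by blast
qed (use assms le_g in auto)

lemma second_kind_ext: "minimal_extension_second_kind L0 ext"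
proof -
  have "\<exists>a. join_irreducible L0 a \<and> ji_component ext h a" if h: "join_irreducible ext h" for h
  proof -
    consider "h \<in> L0" | "h = x1" | "h = x2" using join_irreducible_ext_cases[OF h] by blast
    then show ?thesis
    proof cases
      case 1
      \<comment> \<open>Join-irreducibility in \<open>ext\<close> restricts to \<open>L0\<close>, so
        \<open>h\<close> serves as a component of itself.\<close>
      then show ?thesis
        using h join_irreducible_subset[of ext h L0] join_irreducible_component_self ext_intros(1)
        by blast
    next
      case 2
      then show ?thesis using h ji x1_component_g by blast
    next
      case 3
      then show ?thesis
        using h ji primitive_pair.x1_component_g[OF swap] by (auto simp: ext_swap)
    qed
  qed
  then show ?thesis
    by (auto simp: minimal_extension_second_kind_def minimal_extension_first_kind_def
        minimal_extension_ext)
qed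

end

theorem theorem3p14:
  fixes L0 :: "'a::cbs set" and x1 x2 :: 'a
  assumes "sub_cbs L0" and "finite L0"
    and "primitive_couple_second_kind L0 x1 x2"
  shows "finite (sub_cbs hull (L0 \<union> {x1, x2})) \<and>
         minimal_extension_second_kind L0 (sub_cbs hull (L0 \<union> {x1, x2}))"
proof -
  obtain g where "primitive_pair L0 x1 x2 g"
    using assms unfolding primitive_couple_second_kind_def primitive_pair_def by blast
  then interpret primitive_pair L0 x1 x2 g .
  show ?thesis
    using finite_ext second_kind_ext by (simp only: hull_eq_ext simp_thms)
qed

end
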